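(* Let $(X,d)$ be a metric space. Given a collection of maps $T_1,\dots,T_m:X\to X$, define the set-valued map $T$ from $X$ to subsets of $X$ by $T(x)=\{T_1(x),\dots,T_m(x)\}$. Given a stochastic process $\sigma:\mathbb{Z}_{\ge0}\to\{1,\dots,m\}$, consider an evolution $\{x_n\}_{n\in\mathbb{Z}_{\ge0}}$ of $T$ satisfying $$x_{n+1}=T_{\sigma(n)}(x_n).$$ Assume that: (i) there exists a compact set $W\subseteq X$ that is strongly positively invariant for $T$; (ii) there exists a function $U:W\to\mathbb{R}$ such that $U(w')<U(w)$ for all $w\in W$ and $w'\in T(w)\setminus\{w\}$; (iii) the maps $T_i$, for $i\in\{1,\dots,m\}$, and $U$ are continuous on $W$; and (iv) there exist $p\in\,]0,1[$ and $k\in\mathbb{N}$ such that, for all $i\in\{1,\dots,m\}$ and $n\in\mathbb{Z}_{\ge0}$, there exists $h\in\{1,\dots,k\}$ such that $$\mathbb{P}\big[\sigma(n+h)=i\mid\sigma(n),\dots,\sigma(1)\big]\ge p.$$ If $x_0\in W$, then there exists $c\in\mathbb{R}$ such that almost surely the evolution $\{x_n\}_{n\in\mathbb{Z}_{\ge0}}$ approaches the set $$(F_1\cap\cdots\cap F_m)\cap U^{-1}(c),$$ where $F_i=\{w\in W\mid T_i(w)=w\}$ is the set of fixed points of $T_i$ in $W$, $i\in\{1,\dots,m\}$.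
   Context: A set $W\subset X$ is strongly positively invariant for $T$ if $T(w)\subset W$ for all $w\in W$. An evolution of $T$ is a sequence $\{x_n\}$ in $X$ with $x_{n+1}\in T(x_n)$ for all $n\in\mathbb{Z}_{\ge0}$. A sequence $\{x_n\}$ approaches a set $S$ if $\inf_{s\in S} d(x_n,s)\to0$ as $n\to\infty$.
   Formalization: The constant c is allowed to depend on the realization (a measurable random variable) instead of being one real number fixed before "almost surely"; with a fixed c the claim fails, e.g. when the first random step chooses between two common fixed points with different values of U. *)

theory Defs
  imports "HOL-Probability.Probability"
begin

definition set_valued_map :: "nat \<Rightarrow> (nat \<Rightarrow> 'a \<Rightarrow> 'a) \<Rightarrow> 'a \<Rightarrow> 'a set" where
  "set_valued_map m T x = {T i x | i. i \<in> {1..m}}"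

definition strongly_positively_invariant :: "('a \<Rightarrow> 'a set) \<Rightarrow> 'a set \<Rightarrow> bool" where
  "strongly_positively_invariant F W \<longleftrightarrow> (\<forall>w\<in>W. F w \<subseteq> W)"

definition evolution :: "('a \<Rightarrow> 'a set) \<Rightarrow> (nat \<Rightarrow> 'a) \<Rightarrow> bool" where
  "evolution F x \<longleftrightarrow> (\<forall>n. x (Suc n) \<in> F (x n))"

(* infdist is the infimum of the distances only for a nonempty set (infdist y {} = 0 by
   convention), so nonemptiness is required: no sequence approaches the empty set. *)
definition approaches :: "(nat \<Rightarrow> 'a::metric_space) \<Rightarrow> 'a set \<Rightarrow> bool" where
  "approaches x S \<longleftrightarrow> S \<noteq> {} \<and> (\<lambda>n. infdist (x n) S) \<longlonglongrightarrow> 0"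

definition fixed_points_in :: "'a set \<Rightarrow> ('a \<Rightarrow> 'a) \<Rightarrow> 'a set" where
  "fixed_points_in W f = {w \<in> W. f w = w}"

(* The sigma-algebra generated by s 1, ..., s n. The value s 0 is not part of the history,
   and for n = 0 this is the trivial sigma-algebra on space M. *)
definition history :: "'w measure \<Rightarrow> (nat \<Rightarrow> 'w \<Rightarrow> nat) \<Rightarrow> nat \<Rightarrow> 'w measure" where
  "history M s n = sigma (space M) {s j -` A \<inter> space M | j A. j \<in> {1..n}}"

definition conditional_prob :: "'w measure \<Rightarrow> 'w measure \<Rightarrow> 'w set \<Rightarrow> 'w \<Rightarrow> real" where
  "conditional_prob M F E = real_cond_exp M F (indicator E)"

end

theory Submission
  imports Defs
begin

text \<open>
  Let \<open>D i w = U w - U (T i w)\<close>, which is nonnegative on \<open>W\<close> and vanishes exactly at the fixed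
  points of \<open>T i\<close>. If \<open>D i\<close> stayed away from zero along infinitely many times \<open>n\<close> of an evolution, a
  conditional Borel--Cantelli argument would provide infinitely many of these times at which \<open>T i\<close> is
  applied within the next \<open>k\<close> steps, each costing a fixed amount of \<open>U\<close>, although \<open>U\<close> is bounded
  below. So every \<open>D i (x n)\<close> tends to zero almost surely, while \<open>U (x n)\<close> decreases to some limit \<open>c\<close>,
  and compactness of \<open>W\<close> does the rest.
\<close>

section \<open>A conditional Borel-Cantelli lemma\<close>

text \<open>The product up to \<open>r\<close> is \<open>c\<close> to the power of the number of
  elements of \<open>I\<close> below \<open>r\<close>, which is unbounded. It describes the weights
  \<open>Z r\<close> below on a path without hits.\<close>

lemma product_weights_tendsto_top:
  fixes c :: real
  assumes "1 < c" and "infinite I"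
  shows "(\<lambda>r. ennreal (\<Prod>s<r. if s \<in> I then c else 1)) \<longlonglongrightarrow> top"
proof -
  have "filterlim (\<lambda>r. card ({..<r} \<inter> I)) at_top at_top"
    unfolding filterlim_at_top
  proof
    fix K :: nat
    obtain J where J: "finite J" "card J = K" "J \<subseteq> I"
      using infinite_arbitrarily_large[OF assms(2)] by blast
    then obtain b where b: "J \<subseteq> {..<b}"
      using finite_nat_iff_bounded by blast
    have "K \<le> card ({..<r} \<inter> I)" if "b \<le> r" for r
      using J b that card_mono[of "{..<r} \<inter> I" J] by fastforce
    then show "\<forall>\<^sub>F r in sequentially. K \<le> card ({..<r} \<inter> I)"
      by (auto simp: eventually_sequentially)
  qed
  moreover have "filterlim (\<lambda>n. c ^ n) at_top sequentially"
    using assms(1)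
    by (intro filterlim_at_infinity_imp_filterlim_at_top filterlim_realpow_sequentially_gt1) auto
  ultimately have "filterlim (\<lambda>r. c ^ card ({..<r} \<inter> I)) at_top sequentially"
    by (rule filterlim_compose[rotated])
  moreover have "(\<Prod>s<r. if s \<in> I then c else 1) = c ^ card ({..<r} \<inter> I)" for r
    by (simp add: prod.If_cases)
  ultimately show ?thesis
    by (simp add: ennreal_tendsto_top_eq_at_top)
qed

text \<open>
  The weights \<open>Z r\<close> are multiplied by \<open>1 / (1 - p)\<close> at every miss and set to \<open>0\<close> at the first hit.
  They form a supermartingale that tends to infinity wherever there are infinitely many attempts and
  no hit, so this happens with probability zero by Fatou's lemma.
\<close>

lemma (in prob_space) AE_infinitely_many_attempts_imp_hit:
  assumes sub: "\<And>n. subalgebra M (F n)"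
    and mono: "\<And>n. sets (F n) \<subseteq> sets (F (Suc n))"
    and A: "\<And>n. A n \<in> sets (F n)"
    and B: "\<And>n. B n \<in> sets (F (Suc n))"
    and p: "0 < p" "p < 1"
    and hit: "\<And>n. AE \<omega> in M. p \<le> real_cond_exp M (F n) (indicator (B n)) \<omega>"
  shows "AE \<omega> in M. (\<exists>\<^sub>\<infinity>n. \<omega> \<in> A n) \<longrightarrow> (\<exists>n. \<omega> \<in> A n \<inter> B n)"
proof -
  \<comment> \<open>At an attempt the factor is \<open>c\<close> on a miss and \<open>0\<close> on a
    hit. A miss has conditional probability at most \<open>1 - p\<close>, so the conditional mean of
    the factor is at most \<open>c * (1 - p) = 1\<close>.\<close>
  define c where "c = 1 / (1 - p)"
  have c: "1 < c" using p by (simp add: c_def)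
  define \<phi> where "\<phi> s \<omega> = (if \<omega> \<in> A s then if \<omega> \<in> B s then 0 else c else 1)" for s \<omega>
  define Z where "Z r \<omega> = (\<Prod>s<r. \<phi> s \<omega>)" for r \<omega>
  have sub_Suc: "subalgebra (F (Suc n)) (F n)" for n
    using sub[of n] sub[of "Suc n"] mono by (auto simp: subalgebra_def)
  have Z_Suc: "Z (Suc r) = (\<lambda>\<omega>. Z r \<omega> * \<phi> r \<omega>)" for r
    by (simp add: Z_def fun_eq_iff)
  have Z_meas_F: "Z r \<in> borel_measurable (F r)" for r
  proof (induction r)
    case 0
    then show ?case by (simp add: Z_def)
  next
    case (Suc r)
    have [measurable]: "A r \<in> sets (F (Suc r))" "B r \<in> sets (F (Suc r))"
      using A mono B by blast+
    have [measurable]: "Z r \<in> borel_measurable (F (Suc r))"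
      by (rule measurable_from_subalg[OF sub_Suc Suc])
    show ?case
      unfolding Z_Suc \<phi>_def by measurable
  qed
  then have Z_meas [measurable]: "Z r \<in> borel_measurable M" for r
    using measurable_from_subalg[OF sub] by blast
  have AB_meas [measurable]: "A r \<in> sets M" "B r \<in> sets M" for r
    using A[of r] B[of r] sub[of r] sub[of "Suc r"] by (auto simp: subalgebra_def)
  have Z_nonneg: "0 \<le> Z r \<omega>" for r \<omega>
    using c by (auto simp: Z_def \<phi>_def intro!: prod_nonneg)
  have Z_le: "Z r \<omega> \<le> c ^ r" for r \<omega>
  proof -
    have "Z r \<omega> \<le> (\<Prod>s<r. c)"
      unfolding Z_def using c by (intro prod_mono) (auto simp: \<phi>_def)
    then show ?thesis by simp
  qed
  have int: "integrable M (\<lambda>\<omega>. Z r \<omega> * indicator S \<omega>)" if "S \<in> sets M" for r S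
    using that Z_nonneg Z_le c
    by (intro integrable_const_bound[where B = "c ^ r"])
       (auto simp: indicator_def abs_of_nonneg)
  have int_Z: "integrable M (Z r)" for r
    using Z_nonneg Z_le by (intro integrable_const_bound[where B = "c ^ r"]) auto
  have super: "(\<integral>\<omega>. Z (Suc r) \<omega> \<partial>M) \<le> (\<integral>\<omega>. Z r \<omega> \<partial>M)" for r
  proof -
    interpret finite_measure_subalgebra M "F r"
      by unfold_locales (rule sub)
    \<comment> \<open>\<open>?f\<close> is known at time \<open>r\<close>, so it integrates against
      the conditional expectation of \<open>indicator (B r)\<close> exactly as against the indicator
      itself. This makes \<open>hit\<close> applicable.\<close>
    let ?f = "\<lambda>\<omega>. Z r \<omega> * indicator (A r) \<omega>"
    have fg: "(\<lambda>\<omega>. ?f \<omega> * indicator (B r) \<omega>) = (\<lambda>\<omega>. Z r \<omega> * indicator (A r \<inter> B r) \<omega>)"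
      by (auto simp: indicator_def)
    have int_fg: "integrable M (\<lambda>\<omega>. ?f \<omega> * indicator (B r) \<omega>)"
      unfolding fg by (rule int) auto
    have f_meas: "?f \<in> borel_measurable (F r)"
      using Z_meas_F A by (intro borel_measurable_times borel_measurable_indicator)
    note ce = real_cond_exp_intg[OF int_fg f_meas borel_measurable_indicator[OF AB_meas(2)]]
    have "p * (\<integral>\<omega>. ?f \<omega> \<partial>M) = (\<integral>\<omega>. ?f \<omega> * p \<partial>M)"
      by simp
    also have "\<dots> \<le> (\<integral>\<omega>. ?f \<omega> * real_cond_exp M (F r) (indicator (B r)) \<omega> \<partial>M)"
      using hit[of r] Z_nonneg
      by (intro integral_mono_AE ce integrable_mult_left int AB_meas)
         (auto elim!: eventually_mono intro!: mult_left_mono)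
    also have "\<dots> = (\<integral>\<omega>. ?f \<omega> * indicator (B r) \<omega> \<partial>M)"
      by (rule ce)
    finally have le: "p * (\<integral>\<omega>. ?f \<omega> \<partial>M) \<le> (\<integral>\<omega>. ?f \<omega> * indicator (B r) \<omega> \<partial>M)" .
    \<comment> \<open>Expanding the factor \<open>\<phi> r\<close> in indicators makes the integral
      linear in the terms bounded by \<open>le\<close>. The gain from misses is then compensated
      exactly, because \<open>c - 1 = c * p\<close>.\<close>
    have "Z (Suc r) = (\<lambda>\<omega>. Z r \<omega> + (c - 1) * ?f \<omega> - c * (?f \<omega> * indicator (B r) \<omega>))"
      by (auto simp: Z_Suc \<phi>_def indicator_def fun_eq_iff algebra_simps)
    then have "(\<integral>\<omega>. Z (Suc r) \<omega> \<partial>M)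
        = (\<integral>\<omega>. Z r \<omega> \<partial>M) + (c - 1) * (\<integral>\<omega>. ?f \<omega> \<partial>M) - c * (\<integral>\<omega>. ?f \<omega> * indicator (B r) \<omega> \<partial>M)"
      using int_Z int[OF AB_meas(1)] int_fg by simp
    also have "c - 1 = c * p"
      using p by (simp add: c_def field_simps)
    finally show ?thesis
      using mult_left_mono[OF le, of c] c by (simp add: mult.assoc)
  qed
  have "(\<integral>\<omega>. Z r \<omega> \<partial>M) \<le> 1" for r
  proof (induction r)
    case 0
    then show ?case by (simp add: Z_def prob_space)
  next
    case (Suc r)
    then show ?case using super[of r] by simp
  qed
  then have "(\<integral>\<^sup>+\<omega>. ennreal (Z r \<omega>) \<partial>M) \<le> 1" for r
    using int_Z Z_nonneg by (simp add: nn_integral_eq_integral ennreal_le_1)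
  then have "(\<integral>\<^sup>+\<omega>. liminf (\<lambda>r. ennreal (Z r \<omega>)) \<partial>M) \<le> 1"
    by (intro order_trans[OF nn_integral_liminf] Liminf_le) auto
  then have "(\<integral>\<^sup>+\<omega>. liminf (\<lambda>r. ennreal (Z r \<omega>)) \<partial>M) \<noteq> \<infinity>"
    by (auto simp: top_unique)
  then have "AE \<omega> in M. liminf (\<lambda>r. ennreal (Z r \<omega>)) \<noteq> \<infinity>"
    by (intro nn_integral_noteq_infinite) auto
  then show ?thesis
  proof eventually_elim
    case (elim \<omega>)
    have "\<exists>n. \<omega> \<in> A n \<inter> B n" if "\<exists>\<^sub>\<infinity>n. \<omega> \<in> A n"
    proof (rule ccontr)
      assume "\<not> ?thesis"
      then have "Z r \<omega> = (\<Prod>s<r. if s \<in> {n. \<omega> \<in> A n} then c else 1)" for r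
        by (auto simp: Z_def \<phi>_def intro!: prod.cong)
      moreover have "infinite {n. \<omega> \<in> A n}"
        using that by (simp add: INFM_iff_infinite)
      ultimately have "(\<lambda>r. ennreal (Z r \<omega>)) \<longlonglongrightarrow> top"
        using product_weights_tendsto_top[OF c, of "{n. \<omega> \<in> A n}"] by simp
      then show False
        using elim by (auto dest: lim_imp_Liminf[rotated])
    qed
    then show ?case by blast
  qed
qed

lemma infinite_residue:
  fixes k :: nat
  assumes "infinite I" and "0 < k"
  obtains l where "infinite {n \<in> I. n mod k = l}" "l < k"
proof -
  have "(\<lambda>n. n mod k) ` I \<subseteq> {..<k}"
    using assms(2) by auto
  then have "finite ((\<lambda>n. n mod k) ` I)"
    using finite_subset by blast
  then obtain a where "a \<in> I" "infinite {n \<in> I. n mod k = a mod k}"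
    using pigeonhole_infinite[OF assms(1)] by blast
  then show thesis
    using that assms(2) by auto
qed

text \<open>\<open>B n\<close> is decided only by time \<open>n + k\<close>, so the previous lemma
  is applied along each progression \<open>a + k * r\<close>, whose consecutive times are far enough
  apart. Letting the starting point \<open>a\<close> grow turns one hit into infinitely
  many.\<close>

lemma (in prob_space) AE_infinitely_many_attempts_imp_infinitely_many_hits:
  assumes sub: "\<And>n. subalgebra M (F n)"
    and mono: "\<And>n. sets (F n) \<subseteq> sets (F (Suc n))"
    and A: "\<And>n. A n \<in> sets (F n)"
    and B: "\<And>n. B n \<in> sets (F (n + k))"
    and k: "0 < k"
    and p: "0 < p" "p < 1"
    and hit: "\<And>n. AE \<omega> in M. p \<le> real_cond_exp M (F n) (indicator (B n)) \<omega>"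
  shows "AE \<omega> in M. (\<exists>\<^sub>\<infinity>n. \<omega> \<in> A n) \<longrightarrow> (\<exists>\<^sub>\<infinity>n. \<omega> \<in> A n \<inter> B n)"
proof -
  have mono': "sets (F a) \<subseteq> sets (F b)" if "a \<le> b" for a b
    using lift_Suc_mono_le[of "\<lambda>n. sets (F n)", OF mono that] .
  have "AE \<omega> in M. (\<exists>\<^sub>\<infinity>r. \<omega> \<in> A (a + k * r)) \<longrightarrow> (\<exists>r. \<omega> \<in> A (a + k * r) \<inter> B (a + k * r))" for a
  proof (rule AE_infinitely_many_attempts_imp_hit[where F = "\<lambda>r. F (a + k * r)", OF sub _ A _ p hit])
    show "sets (F (a + k * r)) \<subseteq> sets (F (a + k * Suc r))" for r
      by (rule mono') simp
    show "B (a + k * r) \<in> sets (F (a + k * Suc r))" for r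
      using B[of "a + k * r"] by (simp add: add_ac)
  qed
  then have "AE \<omega> in M. \<forall>a. (\<exists>\<^sub>\<infinity>r. \<omega> \<in> A (a + k * r)) \<longrightarrow>
      (\<exists>r. \<omega> \<in> A (a + k * r) \<inter> B (a + k * r))"
    by (simp add: AE_all_countable)
  then show ?thesis
  proof eventually_elim
    case (elim \<omega>)
    have "\<exists>n\<ge>N. \<omega> \<in> A n \<inter> B n" if inf: "\<exists>\<^sub>\<infinity>n. \<omega> \<in> A n" for N
    proof -
      have "infinite {n. \<omega> \<in> A n}"
        using inf by (simp add: INFM_iff_infinite)
      then obtain l where l: "infinite {n \<in> {n. \<omega> \<in> A n}. n mod k = l}" "l < k"
        using infinite_residue[OF _ k] by blast
      \<comment> \<open>The progression from \<open>a\<close> starts at \<open>N\<close> or later,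
        so a hit on it is late enough. It runs through the residue class \<open>l\<close>, so it
        contains all but finitely many attempts of that class.\<close>
      define a where "a = l + k * N"
      have "\<exists>\<^sub>\<infinity>r. \<omega> \<in> A (a + k * r)"
        unfolding INFM_nat_le
      proof
        fix R
        obtain n where n: "n \<ge> a + k * R" "\<omega> \<in> A n" "n mod k = l"
          using l(1) unfolding infinite_nat_iff_unbounded_le by blast
        define r where "r = n div k - N"
        have "k * (N + R) \<le> n"
          using n(1) by (simp add: a_def algebra_simps)
        then have "N + R \<le> n div k"
          using k by (simp add: less_eq_div_iff_mult_less_eq mult.commute)
        then have "R \<le> r" "k * N + k * r = k * (n div k)"
          by (simp_all add: r_def flip: distrib_left)
        moreover from this have "n = a + k * r"
          using n(3) mult_div_mod_eq[of k n] by (simp add: a_def)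
        ultimately show "\<exists>r\<ge>R. \<omega> \<in> A (a + k * r)"
          using n(2) by blast
      qed
      then obtain r where "\<omega> \<in> A (a + k * r) \<inter> B (a + k * r)"
        using elim by blast
      moreover have "N \<le> a + k * r"
        using mult_le_mono1[of 1 k N] k unfolding a_def by linarith
      ultimately show ?thesis
        by blast
    qed
    then show ?case
      by (auto simp: INFM_nat_le)
  qed
qed

section \<open>Compactness and functions with common zeros\<close>

text \<open>On the compact set where the absolute value of \<open>g\<close> is at least
  \<open>e\<close>, that of \<open>f\<close> has no zero and hence, unless the set is empty, a
  positive minimum, which serves as \<open>d\<close>.\<close>

lemma compact_small_imp_small:
  fixes f g :: "'a::metric_space \<Rightarrow> real"
  assumes W: "compact W" and f: "continuous_on W f" and g: "continuous_on W g"
    and zero: "\<And>w. w \<in> W \<Longrightarrow> f w = 0 \<Longrightarrow> g w = 0" and e: "0 < e"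
  shows "\<exists>d>0. \<forall>w\<in>W. \<bar>f w\<bar> < d \<longrightarrow> \<bar>g w\<bar> < e"
proof -
  define K where "K = W \<inter> {w \<in> W. e \<le> \<bar>g w\<bar>}"
  have "closedin (top_of_set W) {w \<in> W. e \<le> \<bar>g w\<bar>}"
    using continuous_closedin_preimage[of W "\<lambda>w. \<bar>g w\<bar>" "{e..}"] g
    by (auto simp: vimage_def Int_def intro!: continuous_intros)
  then have K: "compact K"
    using W by (metis K_def closedin_compact inf.absorb_iff2 Collect_restrict)
  show ?thesis
  proof (cases "K = {}")
    case True
    then show ?thesis
      by (intro exI[of _ 1]) (auto simp: K_def not_le)
  next
    case False
    have "continuous_on K (\<lambda>w. \<bar>f w\<bar>)"
      using f by (intro continuous_intros continuous_on_subset[OF f]) (auto simp: K_def)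
    then obtain v where v: "v \<in> K" "\<And>w. w \<in> K \<Longrightarrow> \<bar>f v\<bar> \<le> \<bar>f w\<bar>"
      using continuous_attains_inf[OF K False] by blast
    have "f v \<noteq> 0"
      using v(1) zero e by (auto simp: K_def)
    then show ?thesis
      using v(2) by (intro exI[of _ "\<bar>f v\<bar>"]) (force simp: K_def not_le[symmetric])
  qed
qed

lemma compact_tendsto_0_imp_tendsto_0:
  fixes f g :: "'a::metric_space \<Rightarrow> real"
  assumes "compact W" "continuous_on W f" "continuous_on W g"
    and "\<And>w. w \<in> W \<Longrightarrow> f w = 0 \<Longrightarrow> g w = 0"
    and x: "\<And>n. x n \<in> W" and lim: "(\<lambda>n. f (x n)) \<longlonglongrightarrow> 0"
  shows "(\<lambda>n. g (x n)) \<longlonglongrightarrow> 0"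
proof (rule tendstoI)
  fix e :: real
  assume "0 < e"
  then obtain d where d: "d > 0" "\<forall>w\<in>W. \<bar>f w\<bar> < d \<longrightarrow> \<bar>g w\<bar> < e"
    using compact_small_imp_small[OF assms(1-4)] by blast
  show "\<forall>\<^sub>F n in sequentially. dist (g (x n)) 0 < e"
    using tendstoD[OF lim d(1)] by eventually_elim (use d(2) x in auto)
qed

text \<open>A cluster point of \<open>x\<close> in \<open>W\<close> is a zero of \<open>f\<close>,
  which gives the nonemptiness that \<open>approaches\<close> demands. The distance to the zero set
  vanishes wherever \<open>f\<close> does, so it tends to zero along with \<open>f\<close>.\<close>

lemma approaches_zero_set:
  fixes f :: "'a::metric_space \<Rightarrow> real"
  assumes W: "compact W" and f: "continuous_on W f"
    and x: "\<And>n. x n \<in> W" and lim: "(\<lambda>n. f (x n)) \<longlonglongrightarrow> 0"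
  shows "approaches x {w \<in> W. f w = 0}"
proof -
  obtain l r where l: "l \<in> W" "strict_mono r" "(x \<circ> r) \<longlonglongrightarrow> l"
    using W x unfolding compact_def by blast
  have "((\<lambda>n. f ((x \<circ> r) n)) \<longlonglongrightarrow> f l)"
    using x by (intro continuous_on_tendsto_compose[OF f l(3,1)]) simp
  moreover have "((\<lambda>n. f ((x \<circ> r) n)) \<longlonglongrightarrow> 0)"
    using LIMSEQ_subseq_LIMSEQ[OF lim l(2)] by (simp add: o_def)
  ultimately have "f l = 0"
    using LIMSEQ_unique by blast
  moreover have "(\<lambda>n. infdist (x n) {w \<in> W. f w = 0}) \<longlonglongrightarrow> 0"
    by (rule compact_tendsto_0_imp_tendsto_0[OF W f _ _ x lim])
       (auto intro!: continuous_intros)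
  ultimately show ?thesis
    using l(1) unfolding approaches_def by blast
qed

section \<open>Deterministic analysis of a single trajectory\<close>

text \<open>
  Each map moves \<open>x n\<close> less and less, because the decrease of \<open>U\<close> along the convergent sequence
  \<open>U (x n)\<close> tends to zero. Hence a map whose decrease at \<open>x n\<close> is at least \<open>e\<close> would still have a
  decrease of at least \<open>e / 2\<close> at \<open>x (n + h)\<close> with \<open>h \<le> k\<close>, and eventually cannot be applied there.
\<close>

lemma switching_evolution_approaches:
  fixes x :: "nat \<Rightarrow> 'a::metric_space" and T :: "nat \<Rightarrow> 'a \<Rightarrow> 'a" and U :: "'a \<Rightarrow> real"
  assumes W: "compact W"
    and inv: "\<And>i w. i \<in> {1..m} \<Longrightarrow> w \<in> W \<Longrightarrow> T i w \<in> W"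
    and decr: "\<And>i w. i \<in> {1..m} \<Longrightarrow> w \<in> W \<Longrightarrow> T i w \<noteq> w \<Longrightarrow> U (T i w) < U w"
    and T: "\<And>i. i \<in> {1..m} \<Longrightarrow> continuous_on W (T i)"
    and U: "continuous_on W U"
    and x0: "x 0 \<in> W" and s: "\<And>n. s n \<in> {1..m}" and step: "\<And>n. x (Suc n) = T (s n) (x n)"
    and often: "\<And>i q. i \<in> {1..m} \<Longrightarrow>
      \<exists>\<^sub>\<infinity>n. 1 / real (Suc q) \<le> U (x (Suc n)) - U (T i (x (Suc n))) \<Longrightarrow>
      \<exists>\<^sub>\<infinity>n. 1 / real (Suc q) \<le> U (x (Suc n)) - U (T i (x (Suc n))) \<and> (\<exists>h\<in>{1..k}. s (n + h) = i)"
  shows "approaches x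
    ((\<Inter>i\<in>{1..m}. fixed_points_in W (T i)) \<inter> {w \<in> W. U w = lim (\<lambda>n. U (x n))})"
proof -
  define D where "D i w = U w - U (T i w)" for i w
  have D_cont: "continuous_on W (D i)" if "i \<in> {1..m}" for i
    unfolding D_def using that inv
    by (intro continuous_intros U continuous_on_compose2[OF U T]) auto
  have D_nonneg: "0 \<le> D i w" if "i \<in> {1..m}" "w \<in> W" for i w
    using decr[OF that] by (cases "T i w = w") (auto simp: D_def)
  have D_zero: "D i w = 0 \<longleftrightarrow> T i w = w" if "i \<in> {1..m}" "w \<in> W" for i w
    using decr[OF that] by (cases "T i w = w") (auto simp: D_def)
  have x: "x n \<in> W" for n
    by (induction n) (use x0 s step inv in auto)
  have D_step: "D (s n) (x n) = U (x n) - U (x (Suc n))" for n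
    by (simp add: D_def step)
  have "decseq (\<lambda>n. U (x n))"
    using D_nonneg[OF s x] D_step by (intro decseq_SucI) (metis diff_ge_0_iff_ge)
  moreover obtain b where "\<And>w. w \<in> W \<Longrightarrow> b \<le> U w"
    using continuous_attains_inf[OF W _ U] x0 by blast
  ultimately obtain c where c: "(\<lambda>n. U (x n)) \<longlonglongrightarrow> c"
    using decseq_convergent[of "\<lambda>n. U (x n)" b] x by blast
  have D_s: "(\<lambda>n. D (s n) (x n)) \<longlonglongrightarrow> 0"
    unfolding D_step using tendsto_diff[OF c LIMSEQ_Suc[OF c]] by simp
  have "(\<lambda>n. dist (x n) (x (Suc n))) \<longlonglongrightarrow> 0"
  proof (rule tendstoI)
    fix e :: real
    assume e: "0 < e"
    \<comment> \<open>A map with small decrease moves its argument little, as \<open>D i\<close>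
      vanishes only at fixed points. The active map varies with \<open>n\<close>, so the bound is
      first found for each of the finitely many maps.\<close>
    have "\<forall>\<^sub>F n in sequentially. s n = i \<longrightarrow> dist (x n) (T i (x n)) < e" if i: "i \<in> {1..m}" for i
    proof -
      have "continuous_on W (\<lambda>w. dist w (T i w))"
        using T[OF i] by (intro continuous_intros)
      from compact_small_imp_small[OF W D_cont[OF i] this _ e] D_zero[OF i]
      obtain d where d: "d > 0" "\<forall>w\<in>W. \<bar>D i w\<bar> < d \<longrightarrow> \<bar>dist w (T i w)\<bar> < e"
        by auto
      show ?thesis
        using tendstoD[OF D_s d(1)] by eventually_elim (use d(2) x in auto)
    qed
    then have "\<forall>\<^sub>F n in sequentially. \<forall>i\<in>{1..m}. s n = i \<longrightarrow> dist (x n) (T i (x n)) < e"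
      by (intro eventually_ball_finite) auto
    then show "\<forall>\<^sub>F n in sequentially. dist (dist (x n) (x (Suc n))) 0 < e"
      by eventually_elim (use s step in auto)
  qed
  then have slow: "(\<lambda>n. dist (x n) (x (n + h))) \<longlonglongrightarrow> 0" for h
  proof (induction h)
    case (Suc h)
    then have lim: "(\<lambda>n. dist (x n) (x (n + h)) + dist (x (n + h)) (x (Suc (n + h)))) \<longlonglongrightarrow> 0"
      by (intro tendsto_add_zero LIMSEQ_ignore_initial_segment) auto
    show ?case
      by (rule Lim_null_comparison[OF _ lim]) (simp add: dist_triangle)
  qed simp
  have D_slow: "(\<lambda>n. D i (x n) - D i (x (n + h))) \<longlonglongrightarrow> 0" if i: "i \<in> {1..m}" for i h
  proof (rule tendstoI)
    fix e :: real
    assume "0 < e"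
    then obtain d where d: "d > 0" "\<And>v w. v \<in> W \<Longrightarrow> w \<in> W \<Longrightarrow> dist v w < d \<Longrightarrow> dist (D i v) (D i w) < e"
      using compact_uniformly_continuous[OF D_cont[OF i] W]
      unfolding uniformly_continuous_on_def by blast
    show "\<forall>\<^sub>F n in sequentially. dist (D i (x n) - D i (x (n + h))) 0 < e"
      using tendstoD[OF slow[of h] d(1)]
      by eventually_elim (use d(2) x in \<open>auto simp: dist_real_def\<close>)
  qed
  have D_lim: "(\<lambda>n. D i (x n)) \<longlonglongrightarrow> 0" if i: "i \<in> {1..m}" for i
  \<comment> \<open>The shift to \<open>Suc n\<close> matches \<open>often\<close>: the maps chosen
    by \<open>s (n + h)\<close> with \<open>h \<ge> 1\<close> act on the states from
    \<open>x (Suc n)\<close> on.\<close>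
  proof (rule LIMSEQ_imp_Suc, rule ccontr)
    assume "\<not> (\<lambda>n. D i (x (Suc n))) \<longlonglongrightarrow> 0"
    then obtain e where e: "0 < e" "\<exists>\<^sub>\<infinity>n. e \<le> D i (x (Suc n))"
      using D_nonneg[OF i x] unfolding tendsto_iff
      by (auto simp: not_eventually not_less cofinite_eq_sequentially)
    \<comment> \<open>Rounding the threshold down to this form leaves countably many thresholds, so
      that \<open>often\<close> can be secured almost surely for all of them at once.\<close>
    obtain q where q: "1 / real (Suc q) < e"
      using nat_approx_posE[OF e(1)] by blast
    define \<epsilon> where "\<epsilon> = 1 / real (Suc q)"
    have \<epsilon>: "0 < \<epsilon>" by (simp add: \<epsilon>_def)
    have "\<exists>\<^sub>\<infinity>n. \<epsilon> \<le> D i (x (Suc n))"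
      using e(2) by (rule frequently_elim1) (use q in \<open>simp add: \<epsilon>_def\<close>)
    then have freq: "\<exists>\<^sub>\<infinity>n. \<epsilon> \<le> D i (x (Suc n)) \<and> (\<exists>h\<in>{1..k}. s (n + h) = i)"
      using often[OF i, of q] by (simp add: D_def \<epsilon>_def)
    have "\<forall>\<^sub>F n in sequentially. \<bar>D i (x (Suc n)) - D i (x (n + h))\<bar> < \<epsilon> / 2 \<and>
        D (s (n + h)) (x (n + h)) < \<epsilon> / 2" if h: "h \<in> {1..k}" for h
    proof (rule eventually_conj)
      \<comment> \<open>\<open>x (n + h)\<close> comes only \<open>h - 1\<close> steps after
        \<open>x (Suc n)\<close>.\<close>
      obtain h' where h': "h = Suc h'"
        using h by (cases h) auto
      have "(\<lambda>n. D i (x (Suc n)) - D i (x (n + h))) \<longlonglongrightarrow> 0"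
        using LIMSEQ_Suc[OF D_slow[OF i, of h']] by (simp add: h')
      from tendstoD[OF this, of "\<epsilon> / 2"] \<epsilon>
      show "\<forall>\<^sub>F n in sequentially. \<bar>D i (x (Suc n)) - D i (x (n + h))\<bar> < \<epsilon> / 2"
        by simp
      from tendstoD[OF LIMSEQ_ignore_initial_segment[OF D_s, of h], of "\<epsilon> / 2"] \<epsilon>
      show "\<forall>\<^sub>F n in sequentially. D (s (n + h)) (x (n + h)) < \<epsilon> / 2"
        by (auto elim!: eventually_mono)
    qed
    then have "\<forall>\<^sub>F n in sequentially. \<forall>h\<in>{1..k}. \<bar>D i (x (Suc n)) - D i (x (n + h))\<bar> < \<epsilon> / 2 \<and>
        D (s (n + h)) (x (n + h)) < \<epsilon> / 2"
      by (simp add: eventually_ball_finite_distrib)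
    \<comment> \<open>At such an \<open>n\<close> some \<open>s (n + h)\<close> equals
      \<open>i\<close>, so \<open>D i (x (n + h))\<close> is below \<open>\<epsilon> / 2\<close> and
      yet within \<open>\<epsilon> / 2\<close> of a value that is at least
      \<open>\<epsilon>\<close>.\<close>
    from frequently_eventually_conj[OF freq[unfolded cofinite_eq_sequentially] this]
    obtain n h where "\<epsilon> \<le> D i (x (Suc n))" "\<bar>D i (x (Suc n)) - D i (x (n + h))\<bar> < \<epsilon> / 2"
      "D i (x (n + h)) < \<epsilon> / 2"
      by (force dest: frequently_ex)
    then show False
      by linarith
  qed
  \<comment> \<open>All summands are nonnegative on \<open>W\<close>, so the zero set of
    \<open>f\<close> in \<open>W\<close> is exactly the target set.\<close>
  define f where "f w = (\<Sum>i=1..m. D i w) + \<bar>U w - c\<bar>" for w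
  have "(\<lambda>n. f (x n)) \<longlonglongrightarrow> (\<Sum>i=1..m. 0) + \<bar>c - c\<bar>"
    unfolding f_def by (intro tendsto_intros D_lim c)
  then have f_lim: "(\<lambda>n. f (x n)) \<longlonglongrightarrow> 0"
    by simp
  have "continuous_on W f"
    unfolding f_def by (intro continuous_intros D_cont U)
  then have "approaches x {w \<in> W. f w = 0}"
    by (rule approaches_zero_set[where x = x, OF W _ x f_lim])
  moreover have "f w = 0 \<longleftrightarrow> (\<forall>i\<in>{1..m}. T i w = w) \<and> U w = c" if "w \<in> W" for w
  proof -
    have "f w = 0 \<longleftrightarrow> (\<Sum>i=1..m. D i w) = 0 \<and> \<bar>U w - c\<bar> = 0"
      unfolding f_def using D_nonneg that by (intro add_nonneg_eq_0_iff sum_nonneg) auto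
    also have "(\<Sum>i=1..m. D i w) = 0 \<longleftrightarrow> (\<forall>i\<in>{1..m}. D i w = 0)"
      using D_nonneg that by (intro sum_nonneg_eq_0_iff) auto
    finally show ?thesis
      using D_zero that by auto
  qed
  then have "{w \<in> W. f w = 0}
      = (\<Inter>i\<in>{1..m}. fixed_points_in W (T i)) \<inter> {w \<in> W. U w = c}"
    by (auto simp: fixed_points_in_def)
  ultimately show ?thesis
    by (simp add: limI[OF c])
qed

section \<open>Measurability with respect to the history\<close>

text \<open>Time is shifted by one: if \<open>z\<close> is the state at time 1, the value at
  \<open>n\<close> is the state at time \<open>n + 1\<close>. It depends on \<open>s 1\<close>, ...,
  \<open>s n\<close> only, which are the values recorded by \<open>history\<close>.\<close>

primrec drive :: "(nat \<Rightarrow> 'a \<Rightarrow> 'a) \<Rightarrow> (nat \<Rightarrow> nat) \<Rightarrow> 'a \<Rightarrow> nat \<Rightarrow> 'a" where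
  "drive T s z 0 = z"
| "drive T s z (Suc n) = T (s (Suc n)) (drive T s z n)"

text \<open>States carry the discrete sigma-algebra, for which every map \<open>T i\<close> is
  measurable; in the theorem these maps are continuous only on \<open>W\<close>. Switching preserves
  measurability because the index takes countably many values.\<close>

lemma measurable_switching:
  assumes f: "f \<in> N \<rightarrow>\<^sub>M count_space UNIV"
    and s: "s \<in> N \<rightarrow>\<^sub>M count_space (UNIV :: nat set)"
  shows "(\<lambda>\<omega>. T (s \<omega>) (f \<omega>)) \<in> N \<rightarrow>\<^sub>M count_space UNIV"
  by (rule measurable_compose_countable[OF measurable_compose[OF f] s]) simp

lemma space_history [simp]: "space (history M \<sigma> n) = space M"
  unfolding history_def by (rule space_measure_of) auto

lemma sets_history:
  "sets (history M \<sigma> n) = sigma_sets (space M) {\<sigma> j -` A \<inter> space M | j A. j \<in> {1..n}}"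
  unfolding history_def by (rule sets_measure_of) auto

lemma sets_history_mono: "a \<le> b \<Longrightarrow> sets (history M \<sigma> a) \<subseteq> sets (history M \<sigma> b)"
  unfolding sets_history by (rule sigma_sets_mono') force

lemma subalgebra_history:
  assumes "\<And>n. \<sigma> n \<in> M \<rightarrow>\<^sub>M count_space UNIV"
  shows "subalgebra M (history M \<sigma> n)"
  unfolding subalgebra_def sets_history
  using assms by (auto intro!: sets.sigma_sets_subset measurable_sets)

lemma measurable_history:
  assumes "j \<in> {1..n}"
  shows "\<sigma> j \<in> history M \<sigma> n \<rightarrow>\<^sub>M count_space UNIV"
  using assms by (intro measurableI) (auto simp: sets_history)

lemma measurable_drive:
  "(\<lambda>\<omega>. drive T (\<lambda>n. \<sigma> n \<omega>) z n) \<in> history M \<sigma> n \<rightarrow>\<^sub>M count_space UNIV"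
proof (induction n)
  case (Suc n)
  have "subalgebra (history M \<sigma> (Suc n)) (history M \<sigma> n)"
    using sets_history_mono[of n "Suc n"] by (auto simp: subalgebra_def)
  from measurable_from_subalg[OF this Suc] show ?case
    unfolding drive.simps by (rule measurable_switching[OF _ measurable_history]) simp
qed simp

section \<open>Almost sure convergence of the stochastic evolution\<close>

theorem theorem4p5:
  fixes M :: "'w measure"
    and T :: "nat \<Rightarrow> 'a::metric_space \<Rightarrow> 'a"
    and m :: nat
    and \<sigma> :: "nat \<Rightarrow> 'w \<Rightarrow> nat"
    and x :: "nat \<Rightarrow> 'w \<Rightarrow> 'a"
    and x0 :: 'a
    and W :: "'a set"
    and U :: "'a \<Rightarrow> real"
  assumes "prob_space M"
    and process: "\<And>n. \<sigma> n \<in> M \<rightarrow>\<^sub>M count_space {1..m}"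
    and init: "\<And>\<omega>. \<omega> \<in> space M \<Longrightarrow> x 0 \<omega> = x0"
    and evol: "\<And>\<omega>. \<omega> \<in> space M \<Longrightarrow> evolution (set_valued_map m T) (\<lambda>n. x n \<omega>)"
    and step: "\<And>n \<omega>. \<omega> \<in> space M \<Longrightarrow> x (Suc n) \<omega> = T (\<sigma> n \<omega>) (x n \<omega>)"
    and compact: "compact W"
    and invariant: "strongly_positively_invariant (set_valued_map m T) W"
    and decreasing: "\<And>w w'. w \<in> W \<Longrightarrow> w' \<in> set_valued_map m T w - {w} \<Longrightarrow> U w' < U w"
    and cont_T: "\<And>i. i \<in> {1..m} \<Longrightarrow> continuous_on W (T i)"
    and cont_U: "continuous_on W U"
    and persistent: "\<exists>p k. 0 < p \<and> p < 1 \<and>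
      (\<forall>i\<in>{1..m}. \<forall>n. \<exists>h\<in>{1..k::nat}. AE \<omega> in M.
         conditional_prob M (history M \<sigma> n) {\<omega>' \<in> space M. \<sigma> (n + h) \<omega>' = i} \<omega> \<ge> p)"
    and "x0 \<in> W"
  shows "\<exists>c \<in> borel_measurable M. AE \<omega> in M.
    approaches (\<lambda>n. x n \<omega>)
      ((\<Inter>i\<in>{1..m}. fixed_points_in W (T i)) \<inter> {w \<in> W. U w = c \<omega>})"
proof -
  interpret prob_space M by fact
  obtain p k where p: "0 < p" "p < 1"
    and hit: "\<And>i n. i \<in> {1..m} \<Longrightarrow> \<exists>h\<in>{1..k}. AE \<omega> in M.
      p \<le> real_cond_exp M (history M \<sigma> n) (indicator {\<omega>' \<in> space M. \<sigma> (n + h) \<omega>' = i}) \<omega>"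
    using persistent unfolding conditional_prob_def by blast
  have \<sigma>_meas: "\<sigma> n \<in> M \<rightarrow>\<^sub>M count_space UNIV" for n
    using measurable_compose[OF process, of "\<lambda>i. i"] by simp
  have \<sigma>_range: "\<sigma> n \<omega> \<in> {1..m}" if "\<omega> \<in> space M" for n \<omega>
    using measurable_space[OF process that] by simp
  have x_meas: "x n \<in> M \<rightarrow>\<^sub>M count_space UNIV" for n
  proof (induction n)
    case 0
    then show ?case
      by (subst measurable_cong[OF init]) auto
  next
    case (Suc n)
    then show ?case
      by (subst measurable_cong[OF step]) (auto intro: measurable_switching \<sigma>_meas)
  qed
  have x_drive: "x (Suc n) \<omega> = drive T (\<lambda>n. \<sigma> n \<omega>) (T (\<sigma> 0 \<omega>) x0) n" if "\<omega> \<in> space M" for n \<omega>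
    by (induction n) (use that in \<open>simp_all add: step init\<close>)
  define gap where "gap i w = U w - U (T i w)" for i w
  \<comment> \<open>Since \<open>\<sigma> 0\<close> is not part of the history, \<open>x (Suc n)\<close> need not be measurable with respect to it.
    The evolution after each possible first step \<open>j\<close> is, so these are treated separately.\<close>
  have "AE \<omega> in M. (\<exists>\<^sub>\<infinity>n. 1 / real (Suc q) \<le> gap i (drive T (\<lambda>n. \<sigma> n \<omega>) (T j x0) n)) \<longrightarrow>
      (\<exists>\<^sub>\<infinity>n. 1 / real (Suc q) \<le> gap i (drive T (\<lambda>n. \<sigma> n \<omega>) (T j x0) n) \<and>
        (\<exists>h\<in>{1..k}. \<sigma> (n + h) \<omega> = i))"
    if i: "i \<in> {1..m}" for i j q
  proof -
    \<comment> \<open>The delay supplied by \<open>hit\<close> may depend on \<open>n\<close>, so it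
      is chosen as a function of \<open>n\<close>.\<close>
    obtain h where h: "\<And>n. h n \<in> {1..k}" and hit_h: "\<And>n. AE \<omega> in M.
        p \<le> real_cond_exp M (history M \<sigma> n) (indicator {\<omega>' \<in> space M. \<sigma> (n + h n) \<omega>' = i}) \<omega>"
      using hit[OF i] by metis
    define A where "A n = {\<omega> \<in> space M.
      1 / real (Suc q) \<le> gap i (drive T (\<lambda>n. \<sigma> n \<omega>) (T j x0) n)}" for n
    define B where "B n = {\<omega> \<in> space M. \<sigma> (n + h n) \<omega> = i}" for n
    have A: "A n \<in> sets (history M \<sigma> n)" for n
      using measurable_sets[OF measurable_drive[of T \<sigma> "T j x0" n M], of "{w. 1 / real (Suc q) \<le> gap i w}"]
      by (simp add: A_def vimage_def Int_def conj_commute)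
    \<comment> \<open>The index \<open>n + h n\<close> is at most \<open>n + k\<close>, and it is at
      least 1, as the history omits \<open>\<sigma> 0\<close>.\<close>
    have B: "B n \<in> sets (history M \<sigma> (n + k))" for n
      using measurable_sets[OF measurable_history[of "n + h n" "n + k" \<sigma> M], of "{i}"] h[of n]
      by (simp add: B_def vimage_def Int_def conj_commute)
    have "0 < k"
      using h[of 0] by simp
    have "AE \<omega> in M. (\<exists>\<^sub>\<infinity>n. \<omega> \<in> A n) \<longrightarrow> (\<exists>\<^sub>\<infinity>n. \<omega> \<in> A n \<inter> B n)"
    proof (rule AE_infinitely_many_attempts_imp_infinitely_many_hits[
        where F = "history M \<sigma>", OF _ _ A B \<open>0 < k\<close> p])
      show "subalgebra M (history M \<sigma> n)" for n
        by (rule subalgebra_history) (rule \<sigma>_meas)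
      show "sets (history M \<sigma> n) \<subseteq> sets (history M \<sigma> (Suc n))" for n
        by (rule sets_history_mono) simp
      show "AE \<omega> in M. p \<le> real_cond_exp M (history M \<sigma> n) (indicator (B n)) \<omega>" for n
        using hit_h unfolding B_def .
    qed
    then show ?thesis
      using AE_space
    proof eventually_elim
      case (elim \<omega>)
      have A_iff: "\<omega> \<in> A n \<longleftrightarrow> 1 / real (Suc q) \<le> gap i (drive T (\<lambda>n. \<sigma> n \<omega>) (T j x0) n)" for n
        using elim(2) by (simp add: A_def)
      have B_imp: "\<exists>h\<in>{1..k}. \<sigma> (n + h) \<omega> = i" if "\<omega> \<in> B n" for n
        using h[of n] that by (auto simp: B_def)
      show ?case
        unfolding A_iff[symmetric]
      proof
        assume "\<exists>\<^sub>\<infinity>n. \<omega> \<in> A n"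
        with elim(1) have "\<exists>\<^sub>\<infinity>n. \<omega> \<in> A n \<inter> B n" ..
        then show "\<exists>\<^sub>\<infinity>n. \<omega> \<in> A n \<and> (\<exists>h\<in>{1..k}. \<sigma> (n + h) \<omega> = i)"
          by (rule frequently_elim1) (use B_imp in blast)
      qed
    qed
  qed
  \<comment> \<open>With finitely many \<open>i\<close> and countably many \<open>j\<close> and
    \<open>q\<close>, one null set serves for all of them.\<close>
  then have "AE \<omega> in M. \<forall>i\<in>{1..m}. \<forall>j q.
      (\<exists>\<^sub>\<infinity>n. 1 / real (Suc q) \<le> gap i (drive T (\<lambda>n. \<sigma> n \<omega>) (T j x0) n)) \<longrightarrow>
      (\<exists>\<^sub>\<infinity>n. 1 / real (Suc q) \<le> gap i (drive T (\<lambda>n. \<sigma> n \<omega>) (T j x0) n) \<and>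
        (\<exists>h\<in>{1..k}. \<sigma> (n + h) \<omega> = i))"
    by (simp add: AE_all_countable AE_finite_all)
  \<comment> \<open>The level is the limit of \<open>U\<close> along the trajectory, a random
    variable that may differ between outcomes.\<close>
  then have "AE \<omega> in M. approaches (\<lambda>n. x n \<omega>)
      ((\<Inter>i\<in>{1..m}. fixed_points_in W (T i)) \<inter> {w \<in> W. U w = lim (\<lambda>n. U (x n \<omega>))})"
    using AE_space
  proof eventually_elim
    case (elim \<omega>)
    show ?case
    proof (rule switching_evolution_approaches[where s = "\<lambda>n. \<sigma> n \<omega>" and k = k,
          OF compact _ _ cont_T cont_U])
      show "T i w \<in> W" if "i \<in> {1..m}" "w \<in> W" for i w
        using invariant that
        unfolding strongly_positively_invariant_def set_valued_map_def by blast
      show "U (T i w) < U w" if "i \<in> {1..m}" "w \<in> W" "T i w \<noteq> w" for i w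
        using decreasing[OF that(2)] that unfolding set_valued_map_def by blast
      show "x 0 \<omega> \<in> W"
        using init elim(2) \<open>x0 \<in> W\<close> by simp
      show "x (Suc n) \<omega> = T (\<sigma> n \<omega>) (x n \<omega>)" "\<sigma> n \<omega> \<in> {1..m}" for n
        using step \<sigma>_range elim(2) by blast+
      \<comment> \<open>The first step actually taken corresponds to
        \<open>j = \<sigma> 0 \<omega>\<close>. The null set is common to all \<open>j\<close>, so
        this instance may be selected separately for each \<open>\<omega>\<close>.\<close>
      show "\<exists>\<^sub>\<infinity>n. 1 / real (Suc q) \<le> U (x (Suc n) \<omega>) - U (T i (x (Suc n) \<omega>)) \<and>
          (\<exists>h\<in>{1..k}. \<sigma> (n + h) \<omega> = i)"
        if "i \<in> {1..m}" "\<exists>\<^sub>\<infinity>n. 1 / real (Suc q) \<le> U (x (Suc n) \<omega>) - U (T i (x (Suc n) \<omega>))" for i q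
        using elim(1) that unfolding x_drive[OF elim(2)] gap_def by blast
    qed
  qed
  moreover have "(\<lambda>\<omega>. lim (\<lambda>n. U (x n \<omega>))) \<in> borel_measurable M"
    by (intro borel_measurable_lim_metric measurable_compose[OF x_meas]) simp
  ultimately show ?thesis
    by (rule bexI)
qed

end
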